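(* Let $f$ be twice continuously differentiable with $\nabla^2 f(x)=\alpha\,\mathrm{Id}$ for all $x\in X$, for some $\alpha>0$, and suppose that $A:X\to Y$ is bounded from below with constant $\beta>0$, i.e. $\|Ax\|_Y^2\ge\beta\|x\|_X^2$ for all $x\in X$. Let $(x,\lambda):[0,+\infty)\to X\times Y$ be a solution of the Arrow--Hurwicz differential system (AH). Then, for any $(\xi,\eta)\in S\times M$, the following assertions hold: (i) If $\alpha^2<4\beta$, then, as $t\to+\infty$, $$L(x(t),\eta)-L(\xi,\lambda(t))=\mathcal O(e^{-\alpha t}),\quad \|(\dot x(t),\dot\lambda(t))\|^2=\mathcal O(e^{-\alpha t}),\quad \|x(t)-\xi\|_X^2=\mathcal O(e^{-\alpha t}).$$ (ii) If $\alpha^2=4\beta$, then, as $t\to+\infty$, $$L(x(t),\eta)-L(\xi,\lambda(t))=\mathcal O(t^2e^{-\alpha t}),\quad \|(\dot x(t),\dot\lambda(t))\|^2=\mathcal O(t^2e^{-\alpha t}),\quad \|x(t)-\xi\|_X^2=\mathcal O(t^2e^{-\alpha t}).$$ (iii) If $\alpha^2>4\beta$, then, with $\delta=\sqrt{\alpha^2-4\beta}$, as $t\to+\infty$, $$L(x(t),\eta)-L(\xi,\lambda(t))=\mathcal O(e^{-(\alpha-\delta)t}),\quad \|(\dot x(t),\dot\lambda(t))\|^2=\mathcal O(e^{-(\alpha-\delta)t}),\quad \|x(t)-\xi\|_X^2=\mathcal O(e^{-(\alpha-\delta)t}).$$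
   Context: $X$ and $Y$ are real Hilbert spaces with inner products $\langle\cdot,\cdot\rangle_X$, $\langle\cdot,\cdot\rangle_Y$ and norms $\|\cdot\|_X,\|\cdot\|_Y$; $X\times Y$ carries the product Hilbert structure, with norm $\|\cdot\|$. Standing assumptions: $f:X\to\mathbb R$ is convex and continuously differentiable; $\nabla f:X\to X$ is Lipschitz continuous on bounded sets; $A:X\to Y$ is linear and continuous with adjoint $A^*$; $b\in Y$; the set $S\times M$ defined below is non-empty. $\nabla^2 f$ denotes the Hessian of $f$ and $\mathrm{Id}$ the identity operator. The Lagrangian is $L:X\times Y\to\mathbb R$, $L(x,\lambda)=f(x)+\langle\lambda,Ax-b\rangle_Y$. A saddle point of $L$ is a pair $(\bar x,\bar\lambda)\in X\times Y$ with $L(\bar x,\lambda)\le L(\bar x,\bar\lambda)\le L(x,\bar\lambda)$ for all $(x,\lambda)\in X\times Y$; the set of saddle points of $L$ is denoted by $S\times M\subset X\times Y$. The system (AH) is $$\dot x+\nabla f(x)+A^*\lambda=0_X,\qquad \dot\lambda+b-Ax=0_Y,$$ with initial data $(x(0),\lambda(0))=(x_0,\lambda_0)\in X\times Y$; a solution is a function $(x,\lambda)\in\mathcal C^1([0,+\infty);X\times Y)$ satisfying the system on $[0,+\infty)$ with these initial data. *)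

theory Defs
  imports "HOL-Analysis.Analysis" "HOL-Library.Landau_Symbols"
begin

text \<open>Real Hilbert spaces are types of sort \<open>{real_inner, complete_space}\<close>. The norm on the
  product type is the one induced by the sum of the two inner products.\<close>

definition lagrangian ::
  "('a::real_inner \<Rightarrow> real) \<Rightarrow> ('a \<Rightarrow> 'b::real_inner) \<Rightarrow> 'b \<Rightarrow> 'a \<Rightarrow> 'b \<Rightarrow> real"
  where "lagrangian f A b x l = f x + l \<bullet> (A x - b)"

definition saddle_points :: "('a \<Rightarrow> 'b \<Rightarrow> real) \<Rightarrow> ('a \<times> 'b) set"
  where "saddle_points L =
    {(\<xi>, \<eta>). \<forall>x l. L \<xi> l \<le> L \<xi> \<eta> \<and> L \<xi> \<eta> \<le> L x \<eta>}"

text \<open>Derivative of a curve on \<open>[0, \<infinity>)\<close>; at \<open>0\<close> it is the right derivative.\<close>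

abbreviation vel :: "(real \<Rightarrow> 'a::real_normed_vector) \<Rightarrow> real \<Rightarrow> 'a"
  where "vel z t \<equiv> vector_derivative z (at t within {0..})"

definition C1_halfline :: "(real \<Rightarrow> 'a::real_normed_vector) \<Rightarrow> bool"
  where "C1_halfline z \<longleftrightarrow>
    (\<forall>t\<ge>0. z differentiable (at t within {0..})) \<and> continuous_on {0..} (vel z)"

text \<open>The argument \<open>g\<close> stands for the gradient of the objective.\<close>

definition AH_solution ::
  "('a::real_inner \<Rightarrow> 'a) \<Rightarrow> ('a \<Rightarrow> 'b::real_inner) \<Rightarrow> 'b \<Rightarrow> 'a \<Rightarrow> 'b
    \<Rightarrow> (real \<Rightarrow> 'a) \<Rightarrow> (real \<Rightarrow> 'b) \<Rightarrow> bool"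
  where "AH_solution g A b x\<^sub>0 l\<^sub>0 x l \<longleftrightarrow>
    C1_halfline (\<lambda>t. (x t, l t)) \<and>
    (\<forall>t\<ge>0. vel x t + g (x t) + adjoint A (l t) = 0 \<and> vel l t + b - A (x t) = 0) \<and>
    x 0 = x\<^sub>0 \<and> l 0 = l\<^sub>0"

end

theory Submission
  imports Defs
begin

text \<open>Writing \<open>u = x - \<xi>\<close> and \<open>v = \<lambda> - \<eta>\<close>, the system becomes \<open>u' = - \<alpha> u - A\<^sup>* v\<close>, \<open>v' = A u\<close>, and the
  Lagrangian gap equals \<open>\<alpha>/2 \<parallel>u\<parallel>\<^sup>2\<close>. The rescaled curve \<open>w = exp (\<alpha> t / 2) u\<close> solves the undamped
  equation \<open>w'' + (A\<^sup>* A - \<alpha>\<^sup>2/4) w = 0\<close>, so the energy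
  \<open>E = \<parallel>w'\<parallel>\<^sup>2 + \<parallel>A w\<parallel>\<^sup>2 - \<alpha>\<^sup>2/4 \<parallel>w\<parallel>\<^sup>2\<close> is constant and
  \<open>\<parallel>w'\<parallel>\<^sup>2 + (\<beta> - \<alpha>\<^sup>2/4) \<parallel>w\<parallel>\<^sup>2 \<le> E\<close>. According to the sign of \<open>\<beta> - \<alpha>\<^sup>2/4\<close>, this makes \<open>w\<close> bounded, of at
  most linear growth, or of growth \<open>exp (\<delta> t / 2)\<close>; the energy identity turns a bound on \<open>w\<close>
  into one on the velocities.\<close>

section \<open>Riesz representation and Hilbert space adjoints\<close>

text \<open>Riesz representation by the direct method: the functional \<open>J\<close> attains its
  minimum because the space is complete, and the first-order condition at the minimiser identifies
  the representing vector.\<close>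

lemma bounded_linear_functional_eq_inner:
  fixes \<phi> :: "'a::{real_inner, complete_space} \<Rightarrow> real"
  assumes "bounded_linear \<phi>"
  shows "\<exists>v. \<forall>h. \<phi> h = h \<bullet> v"
proof -
  interpret \<phi>: bounded_linear \<phi> by fact
  define J where "J y = (norm y)\<^sup>2 - 2 * \<phi> y" for y
  obtain K where K: "\<And>y. norm (\<phi> y) \<le> norm y * K"
    using \<phi>.bounded by blast
  \<comment> \<open>Bounding \<open>\<phi> y\<close> by \<open>K * norm y\<close> and completing the
    square bounds \<open>J\<close> from below.\<close>
  have "- K\<^sup>2 \<le> J y" for y
  proof -
    have "0 \<le> (norm y - K)\<^sup>2" by simp
    with K[of y] show ?thesis
      unfolding J_def power2_diff by (simp add: algebra_simps abs_le_iff)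
  qed
  hence bdd: "bdd_below (range J)" by (auto intro!: bdd_belowI)
  define m where "m = (INF y. J y)"
  have m_le: "m \<le> J y" for y
    unfolding m_def using bdd by (rule cINF_lower) simp
  have "\<exists>y. J y < m + 1 / real (Suc n)" for n
    using cINF_less_iff[of UNIV J "m + 1 / real (Suc n)"] bdd unfolding m_def by auto
  then obtain s where s: "\<And>n. J (s n) < m + 1 / real (Suc n)" by metis
  \<comment> \<open>Parallelogram law at the midpoint: the linear parts of \<open>J\<close> cancel,
    so nearly minimal points lie close together and every minimising sequence is Cauchy.\<close>
  have par: "(norm (y - z))\<^sup>2 \<le> 2 * (J y - m) + 2 * (J z - m)" for y z
  proof -
    define mid where "mid = (1/2) *\<^sub>R (y + z)"
    have "J y + J z - 2 * J mid = (norm (y - z))\<^sup>2 / 2"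
      unfolding mid_def J_def \<phi>.scaleR \<phi>.add power2_norm_eq_inner
      by (simp add: inner_simps inner_commute algebra_simps)
    with m_le[of mid] show ?thesis by (simp add: algebra_simps)
  qed
  have "Cauchy s"
  proof (rule metric_CauchyI)
    fix e :: real
    assume "e > 0"
    hence "e\<^sup>2 / 4 > 0" by simp
    then obtain N where N: "1 / real (Suc N) < e\<^sup>2 / 4"
      using nat_approx_posE by blast
    have small: "J (s n) - m < e\<^sup>2 / 4" if "n \<ge> N" for n
    proof -
      have "1 / real (Suc n) \<le> 1 / real (Suc N)"
        using that by (intro divide_left_mono) auto
      with s[of n] N show ?thesis by linarith
    qed
    show "\<exists>M. \<forall>p\<ge>M. \<forall>q\<ge>M. dist (s p) (s q) < e"
    proof (intro exI[of _ N] allI impI)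
      fix p q
      assume "N \<le> p" "N \<le> q"
      hence "(norm (s p - s q))\<^sup>2 < e\<^sup>2"
        using par[of "s p" "s q"] small[of p] small[of q] by simp
      thus "dist (s p) (s q) < e"
        using \<open>e > 0\<close> power2_less_imp_less[of _ e] by (simp add: dist_norm)
    qed
  qed
  then obtain v where v: "s \<longlonglongrightarrow> v"
    using Cauchy_convergent convergent_def by blast
  have "(\<lambda>n. J (s n)) \<longlonglongrightarrow> J v"
    unfolding J_def by (intro tendsto_intros \<phi>.tendsto v)
  moreover have "(\<lambda>n. m + 1 / real (Suc n)) \<longlonglongrightarrow> m + 0"
    by (intro tendsto_intros LIMSEQ_inverse_real_of_nat[unfolded inverse_eq_divide])
  ultimately have "J v \<le> m + 0"
    by (rule LIMSEQ_le) (use s less_imp_le in blast)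
  hence min: "J v \<le> J y" for y using m_le[of y] by simp
  have deriv: "(J has_derivative (\<lambda>h. 2 * (v \<bullet> h) - 2 * \<phi> h)) (at v)"
    unfolding J_def power2_norm_eq_inner
    by (auto intro!: derivative_eq_intros \<phi>.has_derivative simp: inner_commute)
  have "(\<lambda>h. 2 * (v \<bullet> h) - 2 * \<phi> h) = (\<lambda>h. 0)"
    by (rule differential_zero_maxmin[of v UNIV J]) (use min deriv in auto)
  hence "\<phi> h = h \<bullet> v" for h
    by (auto simp: fun_eq_iff inner_commute)
  thus ?thesis by blast
qed

text \<open>\<open>adjoint\<close> is defined by choice, so its characteristic identity holds only
  once some adjoint exists; Riesz representation of \<open>A h \<bullet> z\<close> as a functional
  of \<open>h\<close> supplies one for each \<open>z\<close>.\<close>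

lemma adjoint_hilbert:
  fixes A :: "'a::{real_inner, complete_space} \<Rightarrow> 'b::real_inner"
  assumes "bounded_linear A"
  shows "A y \<bullet> z = y \<bullet> adjoint A z"
proof -
  have "\<exists>v. \<forall>h. A h \<bullet> z = h \<bullet> v" for z
    by (intro bounded_linear_functional_eq_inner
        bounded_linear_compose[OF bounded_linear_inner_left assms])
  hence "\<exists>A'. \<forall>y z. A y \<bullet> z = y \<bullet> A' z" by metis
  hence "\<forall>y z. A y \<bullet> z = y \<bullet> adjoint A z"
    unfolding adjoint_def by (rule someI_ex)
  thus ?thesis by blast
qed

text \<open>Linearity follows by testing against all vectors. For the bound, the identity is applied
  at \<open>B z\<close>, and one factor \<open>norm (B z)\<close> is cancelled after
  Cauchy-Schwarz.\<close>

lemma bounded_linear_if_adjoint: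
  fixes A :: "'a::real_inner \<Rightarrow> 'b::real_inner"
  assumes "bounded_linear A" and adj: "\<And>y z. A y \<bullet> z = y \<bullet> B z"
  shows "bounded_linear B"
proof -
  interpret A: bounded_linear A by fact
  obtain K where K: "\<And>y. norm (A y) \<le> norm y * K" and "K \<ge> 0"
    using A.nonneg_bounded by blast
  show ?thesis
  proof (rule bounded_linear_intro)
    show "B (y + z) = B y + B z" for y z
      by (subst vector_eq_ldot[symmetric]) (simp add: inner_add_right adj[symmetric])
    show "B (r *\<^sub>R z) = r *\<^sub>R B z" for r z
      by (subst vector_eq_ldot[symmetric]) (simp add: adj[symmetric])
    show "norm (B z) \<le> norm z * K" for z
    proof (cases "B z = 0")
      case True
      thus ?thesis using \<open>K \<ge> 0\<close> by simp
    next
      case False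
      have "(norm (B z))\<^sup>2 = A (B z) \<bullet> z"
        by (simp add: power2_norm_eq_inner adj)
      also have "\<dots> \<le> norm (A (B z)) * norm z" by (rule norm_cauchy_schwarz)
      also have "\<dots> \<le> norm (B z) * K * norm z"
        by (intro mult_right_mono K) simp
      finally show ?thesis using False by (simp add: power2_eq_square mult.commute)
    qed
  qed
qed

section \<open>Quadratic objectives and saddle point conditions\<close>

lemma gradient_affine:
  fixes g :: "'a::real_normed_vector \<Rightarrow> 'a"
  assumes "\<And>y. (g has_derivative (\<lambda>h. \<alpha> *\<^sub>R h)) (at y)"
  shows "g y = g z + \<alpha> *\<^sub>R (y - z)"
proof -
  have "\<exists>c. \<forall>y\<in>UNIV. g y - \<alpha> *\<^sub>R y = c"
    by (rule has_derivative_zero_constant) (auto intro!: derivative_eq_intros assms)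
  then obtain c where "\<And>y. g y - \<alpha> *\<^sub>R y = c" by blast
  from this[of y] this[of z] show ?thesis by (simp add: algebra_simps)
qed

text \<open>The objective minus its quadratic model at \<open>z\<close> has zero derivative, hence
  is constant. The expansion is exact, which later turns the Lagrangian gap into an
  equality.\<close>

lemma quadratic_if_gradient_affine:
  fixes f :: "'a::real_inner \<Rightarrow> real"
  assumes "\<And>y. GDERIV f y :> g y" and "\<And>y z. g y = g z + \<alpha> *\<^sub>R (y - z)"
  shows "f y = f z + g z \<bullet> (y - z) + \<alpha> / 2 * (norm (y - z))\<^sup>2"
proof -
  have f: "(f has_derivative (\<lambda>h. h \<bullet> g y)) (at y)" for y
    using assms(1) unfolding gderiv_def .
  have "\<exists>c. \<forall>y\<in>UNIV. f y - g z \<bullet> (y - z) - \<alpha> / 2 * (norm (y - z))\<^sup>2 = c"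
  proof (rule has_derivative_zero_constant)
    fix y
    have gy: "g y = g z + \<alpha> *\<^sub>R (y - z)" by (rule assms)
    show "((\<lambda>y. f y - g z \<bullet> (y - z) - \<alpha> / 2 * (norm (y - z))\<^sup>2) has_derivative (\<lambda>h. 0))
            (at y within UNIV)"
      unfolding power2_norm_eq_inner
      by (auto intro!: derivative_eq_intros f
          simp: fun_eq_iff gy inner_simps inner_commute algebra_simps)
  qed simp
  then obtain c where c: "\<And>y. f y - g z \<bullet> (y - z) - \<alpha> / 2 * (norm (y - z))\<^sup>2 = c"
    by blast
  from c[of y] c[of z] show ?thesis by simp
qed

text \<open>Shifting the multiplier by the residual \<open>A \<xi> - b\<close> raises the Lagrangian
  by the squared norm of that residual, which the saddle inequality forbids unless it
  vanishes.\<close>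

lemma saddle_point_feasible:
  assumes "(\<xi>, \<eta>) \<in> saddle_points (lagrangian f A b)"
  shows "A \<xi> = b"
proof -
  have "lagrangian f A b \<xi> (\<eta> + (A \<xi> - b)) \<le> lagrangian f A b \<xi> \<eta>"
    using assms unfolding saddle_points_def by blast
  hence "(A \<xi> - b) \<bullet> (A \<xi> - b) \<le> 0"
    unfolding lagrangian_def inner_add_left by simp
  thus ?thesis
    by (metis inner_gt_zero_iff linorder_not_less right_minus_eq)
qed

text \<open>First-order condition in the primal variable, with the vanishing derivative evaluated in
  the direction \<open>g + B \<eta>\<close> itself.\<close>

lemma saddle_point_stationary:
  assumes "(\<xi>, \<eta>) \<in> saddle_points (lagrangian f A b)"
    and "GDERIV f \<xi> :> g" and A: "bounded_linear A"
    and adj: "\<And>y z. A y \<bullet> z = y \<bullet> B z"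
  shows "g + B \<eta> = 0"
proof -
  have min: "lagrangian f A b \<xi> \<eta> \<le> lagrangian f A b y \<eta>" for y
    using assms(1) unfolding saddle_points_def by blast
  have f: "(f has_derivative (\<lambda>h. h \<bullet> g)) (at \<xi>)"
    using assms(2) unfolding gderiv_def .
  have "((\<lambda>y. lagrangian f A b y \<eta>) has_derivative (\<lambda>h. h \<bullet> g + \<eta> \<bullet> A h)) (at \<xi>)"
    unfolding lagrangian_def
    by (auto intro!: derivative_eq_intros f bounded_linear.has_derivative[OF A])
  hence "(\<lambda>h. h \<bullet> g + \<eta> \<bullet> A h) = (\<lambda>h. 0)"
    by (rule differential_zero_maxmin[of \<xi> UNIV, rotated 2]) (use min in auto)
  hence "(g + B \<eta>) \<bullet> g + \<eta> \<bullet> A (g + B \<eta>) = 0" by (rule fun_cong)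
  hence "(g + B \<eta>) \<bullet> (g + B \<eta>) = 0"
    by (metis adj inner_add_right inner_commute)
  thus ?thesis by simp
qed

section \<open>The rescaled curve and its conserved energy\<close>

lemma has_real_derivative_inner_self:
  fixes h :: "real \<Rightarrow> 'a::real_inner"
  assumes "(h has_vector_derivative d) (at t within S)"
  shows "((\<lambda>t. h t \<bullet> h t) has_real_derivative 2 * (h t \<bullet> d)) (at t within S)"
  using bounded_bilinear.has_vector_derivative[OF bounded_bilinear_inner assms assms]
  by (simp add: has_real_derivative_iff_has_vector_derivative inner_commute)

text \<open>\<open>p\<close> is the derivative of \<open>w\<close> with the equation for
  \<open>u\<close> already substituted. It contains no derivative, so it can be differentiated once
  more using the equations for \<open>u\<close> and \<open>v\<close>.\<close>

lemma rescaled_energy: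
  fixes u :: "real \<Rightarrow> 'a::real_inner" and v :: "real \<Rightarrow> 'b::real_inner"
  assumes A: "bounded_linear A" and adj: "\<And>y z. A y \<bullet> z = y \<bullet> B z"
    and u: "\<And>t. t \<ge> 0 \<Longrightarrow>
      (u has_vector_derivative - \<alpha> *\<^sub>R u t - B (v t)) (at t within {0..})"
    and v: "\<And>t. t \<ge> 0 \<Longrightarrow> (v has_vector_derivative A (u t)) (at t within {0..})"
  defines "w \<equiv> \<lambda>t. exp (\<alpha> * t / 2) *\<^sub>R u t"
    and "p \<equiv> \<lambda>t. exp (\<alpha> * t / 2) *\<^sub>R (- (\<alpha> / 2) *\<^sub>R u t - B (v t))"
  shows "t \<ge> 0 \<Longrightarrow> (w has_vector_derivative p t) (at t within {0..})"
    and "\<exists>E. \<forall>t\<ge>0. (norm (p t))\<^sup>2 + (norm (A (w t)))\<^sup>2 - \<alpha>\<^sup>2 / 4 * (norm (w t))\<^sup>2 = E"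
proof -
  have B: "bounded_linear B"
    using A adj by (rule bounded_linear_if_adjoint)
  interpret A: bounded_linear A by fact
  interpret B: bounded_linear B by fact
  have e: "((\<lambda>t. exp (\<alpha> * t / 2)) has_field_derivative \<alpha> / 2 * exp (\<alpha> * t / 2))
      (at t within {0..})" for t :: real
    by (auto intro!: derivative_eq_intros)
  have w: "(w has_vector_derivative p t) (at t within {0..})" if "t \<ge> 0" for t
  proof -
    \<comment> \<open>Pairing both sides with an arbitrary vector reduces the vector identity to
      real arithmetic.\<close>
    have "e *\<^sub>R (- \<alpha> *\<^sub>R y - q) + (\<alpha> / 2 * e) *\<^sub>R y = e *\<^sub>R (- (\<alpha> / 2) *\<^sub>R y - q)"
      for e and y q :: 'a
      by (subst vector_eq_ldot[symmetric]) (simp add: inner_simps field_simps)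
    thus ?thesis
      unfolding w_def p_def using has_vector_derivative_scaleR[OF e u[OF that]] by simp
  qed
  \<comment> \<open>This is the undamped second-order equation for \<open>w\<close>: the terms in
    \<open>B (v t)\<close> cancel.\<close>
  have p: "(p has_vector_derivative (\<alpha>\<^sup>2 / 4) *\<^sub>R w t - B (A (w t))) (at t within {0..})"
    if "t \<ge> 0" for t
  proof -
    have eq: "e *\<^sub>R (- (\<alpha> / 2) *\<^sub>R (- \<alpha> *\<^sub>R y - q) - r) + (\<alpha> / 2 * e) *\<^sub>R (- (\<alpha> / 2) *\<^sub>R y - q)
        = (\<alpha>\<^sup>2 / 4) *\<^sub>R e *\<^sub>R y - e *\<^sub>R r" for e and y q r :: 'a
      by (subst vector_eq_ldot[symmetric]) (simp add: inner_simps field_simps power2_eq_square)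
    have "((\<lambda>t. - (\<alpha> / 2) *\<^sub>R u t - B (v t)) has_vector_derivative
        - (\<alpha> / 2) *\<^sub>R (- \<alpha> *\<^sub>R u t - B (v t)) - B (A (u t))) (at t within {0..})"
      by (intro has_vector_derivative_diff B.has_vector_derivative v that
          bounded_linear.has_vector_derivative[OF bounded_linear_scaleR_right u])
    from has_vector_derivative_scaleR[OF e this] show ?thesis
      unfolding p_def w_def A.scaleR B.scaleR eq .
  qed
  show "t \<ge> 0 \<Longrightarrow> (w has_vector_derivative p t) (at t within {0..})" by (rule w)
  have "\<exists>E. \<forall>t\<in>{0..}. p t \<bullet> p t + A (w t) \<bullet> A (w t) - \<alpha>\<^sup>2 / 4 * (w t \<bullet> w t) = E"
  proof (rule has_field_derivative_zero_constant)
    fix t :: real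
    assume "t \<in> {0..}"
    hence t: "t \<ge> 0" by simp
    note sq = has_real_derivative_inner_self
    have "p t \<bullet> B (A (w t)) = A (w t) \<bullet> A (p t)"
      unfolding adj[symmetric] by (rule inner_commute)
    \<comment> \<open>The left side is the derivative of the energy; the terms with \<open>A\<close>
      cancel by adjointness, the other two by symmetry.\<close>
    hence zero: "2 * (p t \<bullet> ((\<alpha>\<^sup>2 / 4) *\<^sub>R w t - B (A (w t)))) + 2 * (A (w t) \<bullet> A (p t))
        - \<alpha>\<^sup>2 / 4 * (2 * (w t \<bullet> p t)) = 0"
      by (simp add: inner_diff_right inner_commute[of "w t"])
    show "((\<lambda>t. p t \<bullet> p t + A (w t) \<bullet> A (w t) - \<alpha>\<^sup>2 / 4 * (w t \<bullet> w t))
        has_field_derivative 0) (at t within {0..})"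
      by (rule DERIV_cong[OF DERIV_diff[OF
            DERIV_add[OF sq[OF p[OF t]] sq[OF A.has_vector_derivative[OF w[OF t]]]]
            DERIV_cmult[OF sq[OF w[OF t]]]] zero])
  qed simp
  thus "\<exists>E. \<forall>t\<ge>0. (norm (p t))\<^sup>2 + (norm (A (w t)))\<^sup>2 - \<alpha>\<^sup>2 / 4 * (norm (w t))\<^sup>2 = E"
    by (auto simp: power2_norm_eq_inner)
qed

section \<open>Bounds on the curve and on the velocities from the energy\<close>

lemma linear_growth:
  fixes w :: "real \<Rightarrow> 'a::real_inner"
  assumes "\<And>t. t \<ge> 0 \<Longrightarrow> (w has_vector_derivative p t) (at t within {0..})"
    and "\<And>t. t \<ge> 0 \<Longrightarrow> (norm (p t))\<^sup>2 \<le> E" and "t \<ge> 0"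
  shows "norm (w t) \<le> norm (w 0) + sqrt E * t"
proof -
  have "norm (w t - w 0) \<le> sqrt E * norm (t - 0)"
  proof (rule differentiable_bound[of "{0..}"])
    fix s :: real
    assume "s \<in> {0..}"
    thus "(w has_derivative (\<lambda>h. h *\<^sub>R p s)) (at s within {0..})"
      using assms(1) by (simp add: has_vector_derivative_def)
    show "onorm (\<lambda>h. h *\<^sub>R p s) \<le> sqrt E"
      using assms(2)[of s] \<open>s \<in> {0..}\<close>
      by (intro onorm_le) (auto simp: mult.commute[of "sqrt E"] intro!: mult_left_mono real_le_rsqrt)
  qed (use assms(3) in auto)
  thus ?thesis
    using norm_triangle_sub[of "w t" "w 0"] assms(3) by (simp add: norm_minus_commute)
qed

text \<open>A Gronwall argument for the squared norm, shifted by a constant that absorbs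
  \<open>E\<close>.\<close>

lemma exponential_growth:
  fixes w :: "real \<Rightarrow> 'a::real_inner"
  assumes w: "\<And>t. t \<ge> 0 \<Longrightarrow> (w has_vector_derivative p t) (at t within {0..})"
    and p: "\<And>t. t \<ge> 0 \<Longrightarrow> (norm (p t))\<^sup>2 \<le> E + k\<^sup>2 * (norm (w t))\<^sup>2"
    and "k > 0"
  shows "\<exists>C. \<forall>t\<ge>0. (norm (w t))\<^sup>2 \<le> C * exp (2 * k * t)"
proof -
  \<comment> \<open>Chosen so that \<open>E \<le> k\<^sup>2 * c\<close>, which gives the shifted
    square \<open>r\<close> a growth rate of at most \<open>2 * k\<close>.\<close>
  define c where "c = \<bar>E\<bar> / k\<^sup>2"
  define r where "r t = w t \<bullet> w t + c" for t
  define R where "R t = r t * exp (- 2 * k * t)" for t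
  have c: "c \<ge> 0" "E \<le> k\<^sup>2 * c"
    using \<open>k > 0\<close> by (auto simp: c_def)
  have deriv: "(R has_field_derivative (2 * (w t \<bullet> p t) - 2 * k * r t) * exp (- 2 * k * t))
      (at t within {0..})" if "t \<ge> 0" for t
  proof -
    have "(r has_field_derivative 2 * (w t \<bullet> p t)) (at t within {0..})"
      using DERIV_add[OF has_real_derivative_inner_self[OF w[OF that]] DERIV_const[of c]]
      unfolding r_def by simp
    thus ?thesis unfolding R_def
      by (auto intro!: derivative_eq_intros simp: algebra_simps)
  qed
  \<comment> \<open>The inequality is multiplied by \<open>k\<close> so that
    \<open>2ab \<le> a\<^sup>2 + b\<^sup>2\<close> with \<open>a = k * norm (w t)\<close> matches
    the bound on \<open>p\<close>.\<close>
  have sign: "2 * (w t \<bullet> p t) \<le> 2 * k * r t" if "t \<ge> 0" for t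
  proof -
    have "2 * k * (w t \<bullet> p t) \<le> 2 * (k * norm (w t)) * norm (p t)"
      using norm_cauchy_schwarz[of "w t" "p t"] \<open>k > 0\<close> by simp
    also have "\<dots> \<le> (k * norm (w t))\<^sup>2 + (norm (p t))\<^sup>2"
      by (rule sum_squares_bound)
    also have "\<dots> \<le> 2 * k\<^sup>2 * (w t \<bullet> w t) + k\<^sup>2 * c"
      using p[OF that] c unfolding power_mult_distrib power2_norm_eq_inner by linarith
    also have "\<dots> \<le> 2 * k\<^sup>2 * r t"
      unfolding r_def using c by (simp add: algebra_simps)
    finally have "k * (2 * (w t \<bullet> p t)) \<le> k * (2 * k * r t)"
      by (simp add: power2_eq_square algebra_simps)
    thus ?thesis using \<open>k > 0\<close> by simp
  qed
  have "(norm (w t))\<^sup>2 \<le> R 0 * exp (2 * k * t)" if "t \<ge> 0" for t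
  proof -
    have "R t \<le> R 0"
    \<comment> \<open>At \<open>0\<close> only a one-sided derivative is available; the
      open-interval criterion uses derivatives at interior points and continuity at the
      ends.\<close>
    proof (rule DERIV_nonpos_imp_decreasing_open[OF that])
      fix s :: real
      assume s: "0 < s" "s < t"
      hence "at s within {0..} = at s"
        by (intro at_within_interior) simp
      hence "(R has_field_derivative (2 * (w s \<bullet> p s) - 2 * k * r s) * exp (- 2 * k * s)) (at s)"
        using deriv[of s] s by simp
      moreover have "(2 * (w s \<bullet> p s) - 2 * k * r s) * exp (- 2 * k * s) \<le> 0"
        using sign[of s] s by (intro mult_nonpos_nonneg) auto
      ultimately show "\<exists>D. (R has_field_derivative D) (at s) \<and> D \<le> 0" by blast
    next
      have "continuous_on {0..} R"
        using deriv by (intro DERIV_continuous_on) auto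
      thus "continuous_on {0..t} R" by (rule continuous_on_subset) auto
    qed
    hence "r t * (exp (- 2 * k * t) * exp (2 * k * t)) \<le> R 0 * exp (2 * k * t)"
      unfolding R_def[of t] mult.assoc[symmetric] by (intro mult_right_mono) auto
    moreover have "exp (- 2 * k * t) * exp (2 * k * t) = 1"
      by (simp flip: exp_add)
    ultimately have "r t \<le> R 0 * exp (2 * k * t)" by (simp only: mult_1_right)
    thus ?thesis
      using c by (simp add: r_def power2_norm_eq_inner)
  qed
  thus ?thesis by blast
qed

text \<open>At a fixed time \<open>e\<close> is the factor \<open>exp (\<alpha> * t / 2)\<close> and
  \<open>q\<close> the adjoint term, so the pair is the velocity. By the parallelogram law, the
  slack is the sum of the squared norms of \<open>p + (\<alpha> / 2) *\<^sub>R w\<close> and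
  \<open>A w\<close>.\<close>

lemma velocity_bound:
  fixes u q :: "'a::real_inner" and A :: "'a \<Rightarrow> 'b::real_inner"
  assumes "linear A"
    and E: "(norm (e *\<^sub>R (- (\<alpha> / 2) *\<^sub>R u - q)))\<^sup>2 + (norm (A (e *\<^sub>R u)))\<^sup>2
      - \<alpha>\<^sup>2 / 4 * (norm (e *\<^sub>R u))\<^sup>2 = E"
  shows "e\<^sup>2 * (norm (- \<alpha> *\<^sub>R u - q, A u))\<^sup>2 \<le> 2 * E + \<alpha>\<^sup>2 * (norm (e *\<^sub>R u))\<^sup>2"
proof -
  define w where "w = e *\<^sub>R u"
  define p where "p = e *\<^sub>R (- (\<alpha> / 2) *\<^sub>R u - q)"
  have pair: "e\<^sup>2 * (norm (y, z))\<^sup>2 = (norm (e *\<^sub>R y))\<^sup>2 + (norm (e *\<^sub>R z))\<^sup>2"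
    for y :: 'a and z :: 'b
    by (simp add: norm_Pair power_mult_distrib distrib_left)
  have "e *\<^sub>R (- \<alpha> *\<^sub>R u - q) = p - (\<alpha> / 2) *\<^sub>R w"
    by (simp add: p_def w_def algebra_simps flip: scaleR_add_left)
  moreover have "A w = e *\<^sub>R A u"
    unfolding w_def using assms(1) by (rule linear_scale)
  ultimately have "e\<^sup>2 * (norm (- \<alpha> *\<^sub>R u - q, A u))\<^sup>2
      = (norm (p - (\<alpha> / 2) *\<^sub>R w))\<^sup>2 + (norm (A w))\<^sup>2"
    by (simp only: pair)
  moreover have "(norm (p - (\<alpha> / 2) *\<^sub>R w))\<^sup>2 + (norm (p + (\<alpha> / 2) *\<^sub>R w))\<^sup>2
      = 2 * (norm p)\<^sup>2 + \<alpha>\<^sup>2 / 2 * (norm w)\<^sup>2"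
    unfolding power2_norm_eq_inner
    by (simp add: inner_simps inner_commute algebra_simps power2_eq_square)
  moreover have "(norm p)\<^sup>2 + (norm (A w))\<^sup>2 - \<alpha>\<^sup>2 / 4 * (norm w)\<^sup>2 = E"
    using E by (simp add: w_def p_def)
  ultimately show ?thesis
    unfolding w_def[symmetric]
    using zero_le_power2[of "norm (p + (\<alpha> / 2) *\<^sub>R w)"] zero_le_power2[of "norm (A w)"]
    by linarith
qed

section \<open>Decay rates along solutions of the system\<close>

theorem corollary4p2:
  fixes f :: "'a::{real_inner, complete_space} \<Rightarrow> real"
    and grad_f :: "'a \<Rightarrow> 'a"
    and hess_f :: "'a \<Rightarrow> 'a \<Rightarrow>\<^sub>L 'a"
    and A :: "'a \<Rightarrow> 'b::{real_inner, complete_space}"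
    and b :: 'b
    and \<alpha> \<beta> :: real
    and x\<^sub>0 :: 'a and l\<^sub>0 :: 'b
    and x :: "real \<Rightarrow> 'a" and l :: "real \<Rightarrow> 'b"
    and \<xi> :: 'a and \<eta> :: 'b
  assumes "convex_on UNIV f"
    and "\<And>y. GDERIV f y :> grad_f y"
    and "continuous_on UNIV grad_f"
    and "\<And>B. bounded B \<Longrightarrow> \<exists>C. C-lipschitz_on B grad_f"
    and "bounded_linear A"
    and "saddle_points (lagrangian f A b) \<noteq> {}"
    and "\<And>y. (grad_f has_derivative blinfun_apply (hess_f y)) (at y)"
    and "continuous_on UNIV hess_f"
    and "\<alpha> > 0"
    and "\<And>y. hess_f y = \<alpha> *\<^sub>R id_blinfun"
    and "\<beta> > 0"
    and "\<And>y. (norm (A y))\<^sup>2 \<ge> \<beta> * (norm y)\<^sup>2"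
    and "AH_solution grad_f A b x\<^sub>0 l\<^sub>0 x l"
    and "(\<xi>, \<eta>) \<in> saddle_points (lagrangian f A b)"
  shows
    "(\<alpha>\<^sup>2 < 4 * \<beta> \<longrightarrow>
      (\<lambda>t. lagrangian f A b (x t) \<eta> - lagrangian f A b \<xi> (l t)) \<in> O[at_top](\<lambda>t. exp (- \<alpha> * t)) \<and>
      (\<lambda>t. (norm (vel x t, vel l t))\<^sup>2) \<in> O[at_top](\<lambda>t. exp (- \<alpha> * t)) \<and>
      (\<lambda>t. (norm (x t - \<xi>))\<^sup>2) \<in> O[at_top](\<lambda>t. exp (- \<alpha> * t))) \<and>
     (\<alpha>\<^sup>2 = 4 * \<beta> \<longrightarrow>
      (\<lambda>t. lagrangian f A b (x t) \<eta> - lagrangian f A b \<xi> (l t)) \<in> O[at_top](\<lambda>t. t\<^sup>2 * exp (- \<alpha> * t)) \<and>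
      (\<lambda>t. (norm (vel x t, vel l t))\<^sup>2) \<in> O[at_top](\<lambda>t. t\<^sup>2 * exp (- \<alpha> * t)) \<and>
      (\<lambda>t. (norm (x t - \<xi>))\<^sup>2) \<in> O[at_top](\<lambda>t. t\<^sup>2 * exp (- \<alpha> * t))) \<and>
     (\<alpha>\<^sup>2 > 4 * \<beta> \<longrightarrow> (let \<delta> = sqrt (\<alpha>\<^sup>2 - 4 * \<beta>) in
      (\<lambda>t. lagrangian f A b (x t) \<eta> - lagrangian f A b \<xi> (l t)) \<in> O[at_top](\<lambda>t. exp (- (\<alpha> - \<delta>) * t)) \<and>
      (\<lambda>t. (norm (vel x t, vel l t))\<^sup>2) \<in> O[at_top](\<lambda>t. exp (- (\<alpha> - \<delta>) * t)) \<and>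
      (\<lambda>t. (norm (x t - \<xi>))\<^sup>2) \<in> O[at_top](\<lambda>t. exp (- (\<alpha> - \<delta>) * t))))"
proof -
  note A = \<open>bounded_linear A\<close> and saddle = assms(14)
  interpret A: bounded_linear A by fact
  have adj: "A y \<bullet> z = y \<bullet> adjoint A z" for y z
    by (rule adjoint_hilbert[OF A])
  interpret B: bounded_linear "adjoint A"
    using A adj by (rule bounded_linear_if_adjoint)
  define u where "u t = x t - \<xi>" for t
  define v where "v t = l t - \<eta>" for t
  have grad: "grad_f y = grad_f z + \<alpha> *\<^sub>R (y - z)" for y z
    by (rule gradient_affine) (use assms(7,10) in \<open>simp add: scaleR_blinfun.rep_eq\<close>)
  have feasible: "A \<xi> = b"
    using saddle by (rule saddle_point_feasible)
  have stationary: "grad_f \<xi> + adjoint A \<eta> = 0"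
    using saddle assms(2) A adj by (rule saddle_point_stationary)
  \<comment> \<open>Feasibility of \<open>\<xi>\<close> removes \<open>l t\<close>, and stationarity
    cancels the terms linear in \<open>u t\<close>.\<close>
  have gap: "lagrangian f A b (x t) \<eta> - lagrangian f A b \<xi> (l t) = \<alpha> / 2 * (norm (u t))\<^sup>2" for t
  proof -
    have "f (x t) = f \<xi> + grad_f \<xi> \<bullet> u t + \<alpha> / 2 * (norm (u t))\<^sup>2"
      unfolding u_def using assms(2) grad by (rule quadratic_if_gradient_affine)
    moreover have "\<eta> \<bullet> (A (x t) - b) = u t \<bullet> adjoint A \<eta>"
      unfolding u_def adj[symmetric] A.diff feasible by (rule inner_commute)
    moreover have "grad_f \<xi> \<bullet> u t + u t \<bullet> adjoint A \<eta> = 0"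
      by (metis stationary inner_add_right inner_commute inner_zero_right)
    ultimately show ?thesis
      unfolding lagrangian_def feasible by simp
  qed
  have sol: "vel x t = - \<alpha> *\<^sub>R u t - adjoint A (v t)" "vel l t = A (u t)"
    "(x has_vector_derivative vel x t) (at t within {0..})"
    "(l has_vector_derivative vel l t) (at t within {0..})" if "t \<ge> 0" for t
  proof -
    have eqs: "vel x t + grad_f (x t) + adjoint A (l t) = 0" "vel l t + b - A (x t) = 0"
      and diff: "(\<lambda>t. (x t, l t)) differentiable (at t within {0..})"
      using assms(13) that unfolding AH_solution_def C1_halfline_def by auto
    have "(\<lambda>t. fst (x t, l t)) differentiable (at t within {0..})"
      "(\<lambda>t. snd (x t, l t)) differentiable (at t within {0..})"
      using diff has_derivative_fst has_derivative_snd unfolding differentiable_def by blast+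
    thus "(x has_vector_derivative vel x t) (at t within {0..})"
      "(l has_vector_derivative vel l t) (at t within {0..})"
      by (simp_all add: vector_derivative_works)
    have "adjoint A (l t) = adjoint A (v t) + adjoint A \<eta>"
      by (simp add: v_def B.diff)
    moreover have "grad_f (x t) = grad_f \<xi> + \<alpha> *\<^sub>R u t"
      unfolding u_def by (rule grad)
    ultimately have "vel x t + \<alpha> *\<^sub>R u t + adjoint A (v t) + (grad_f \<xi> + adjoint A \<eta>) = 0"
      using eqs(1) by (simp add: algebra_simps)
    thus "vel x t = - \<alpha> *\<^sub>R u t - adjoint A (v t)"
      unfolding stationary by (simp add: algebra_simps eq_neg_iff_add_eq_0)
    show "vel l t = A (u t)"
      using eqs(2) by (simp add: u_def A.diff feasible algebra_simps)
  qed
  have u': "(u has_vector_derivative - \<alpha> *\<^sub>R u t - adjoint A (v t)) (at t within {0..})"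
    if "t \<ge> 0" for t
    using has_vector_derivative_diff[OF sol(3)[OF that] has_vector_derivative_const[of \<xi>]]
    unfolding u_def[abs_def] sol(1)[OF that] by simp
  have v': "(v has_vector_derivative A (u t)) (at t within {0..})" if "t \<ge> 0" for t
    using has_vector_derivative_diff[OF sol(4)[OF that] has_vector_derivative_const[of \<eta>]]
    unfolding v_def[abs_def] sol(2)[OF that] by simp
  define w where "w t = exp (\<alpha> * t / 2) *\<^sub>R u t" for t
  define p where "p t = exp (\<alpha> * t / 2) *\<^sub>R (- (\<alpha> / 2) *\<^sub>R u t - adjoint A (v t))" for t
  have w': "(w has_vector_derivative p t) (at t within {0..})" if "t \<ge> 0" for t
    using rescaled_energy(1)[OF A adj u' v' that] unfolding w_def p_def by simp
  obtain E where E: "\<And>t. t \<ge> 0 \<Longrightarrow>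
      (norm (p t))\<^sup>2 + (norm (A (w t)))\<^sup>2 - \<alpha>\<^sup>2 / 4 * (norm (w t))\<^sup>2 = E"
    using rescaled_energy(2)[OF A adj u' v'] unfolding w_def p_def by auto
  \<comment> \<open>The lower bound on \<open>A\<close> enters here; the sign of the coefficient of
    the second term separates the three regimes.\<close>
  have p_le: "(norm (p t))\<^sup>2 + (\<beta> - \<alpha>\<^sup>2 / 4) * (norm (w t))\<^sup>2 \<le> E" if "t \<ge> 0" for t
    using E[OF that] assms(12)[of "w t"] by (simp add: algebra_simps)
  have exp_sq: "(exp (\<alpha> * t / 2))\<^sup>2 = exp (\<alpha> * t)" for t
    by (simp flip: exp_double)
  have u_w: "(norm (u t))\<^sup>2 = exp (- \<alpha> * t) * (norm (w t))\<^sup>2" for t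
    by (simp add: w_def power_mult_distrib exp_sq flip: mult.assoc exp_add)
  have vel_w: "(norm (vel x t, vel l t))\<^sup>2 \<le> exp (- \<alpha> * t) * (2 * E + \<alpha>\<^sup>2 * (norm (w t))\<^sup>2)"
    if "t \<ge> 0" for t
  proof -
    have "exp (\<alpha> * t) * (norm (vel x t, vel l t))\<^sup>2 \<le> 2 * E + \<alpha>\<^sup>2 * (norm (w t))\<^sup>2"
      unfolding sol(1,2)[OF that] exp_sq[symmetric] w_def
      by (rule velocity_bound[OF A.linear_axioms E[OF that, unfolded w_def p_def]])
    hence "exp (- \<alpha> * t) * (exp (\<alpha> * t) * (norm (vel x t, vel l t))\<^sup>2)
        \<le> exp (- \<alpha> * t) * (2 * E + \<alpha>\<^sup>2 * (norm (w t))\<^sup>2)" by simp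
    thus ?thesis by (simp flip: mult.assoc exp_add)
  qed
  \<comment> \<open>All three regimes reduce to a growth rate \<open>\<rho>\<close> for the squared
    norm of \<open>w\<close>. That \<open>\<rho>\<close> is eventually at least 1 lets it absorb the
    constant \<open>2 * E\<close> in the velocity bound.\<close>
  have rates: "(\<lambda>t. lagrangian f A b (x t) \<eta> - lagrangian f A b \<xi> (l t)) \<in> O[at_top](\<lambda>t. \<rho> t * exp (- \<alpha> * t)) \<and>
      (\<lambda>t. (norm (vel x t, vel l t))\<^sup>2) \<in> O[at_top](\<lambda>t. \<rho> t * exp (- \<alpha> * t)) \<and>
      (\<lambda>t. (norm (x t - \<xi>))\<^sup>2) \<in> O[at_top](\<lambda>t. \<rho> t * exp (- \<alpha> * t))"
    if w_le: "eventually (\<lambda>t. (norm (w t))\<^sup>2 \<le> C * \<rho> t) at_top"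
      and \<rho>: "eventually (\<lambda>t. 1 \<le> \<rho> t) at_top" for C and \<rho> :: "real \<Rightarrow> real"
  proof -
    have "(\<lambda>t. (norm (w t))\<^sup>2) \<in> O[at_top](\<rho>)"
      by (rule bigoI[of _ C]) (use w_le \<rho> in eventually_elim, auto)
    moreover have "(\<lambda>t. 1) \<in> O[at_top](\<rho>)"
      by (rule bigoI[of _ 1]) (use \<rho> in eventually_elim, auto)
    hence "(\<lambda>t. 2 * E) \<in> O[at_top](\<rho>)"
      by (rule landau_o.big_trans[rotated]) simp
    ultimately have 1: "(\<lambda>t. 2 * E + \<alpha>\<^sup>2 * (norm (w t))\<^sup>2) \<in> O[at_top](\<rho>)"
      by (intro sum_in_bigo) auto
    have "(\<lambda>t. (norm (vel x t, vel l t))\<^sup>2)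
        \<in> O[at_top](\<lambda>t. (2 * E + \<alpha>\<^sup>2 * (norm (w t))\<^sup>2) * exp (- \<alpha> * t))"
    proof (rule bigoI[of _ 1])
      show "eventually (\<lambda>t. norm ((norm (vel x t, vel l t))\<^sup>2)
          \<le> 1 * norm ((2 * E + \<alpha>\<^sup>2 * (norm (w t))\<^sup>2) * exp (- \<alpha> * t))) at_top"
        using eventually_ge_at_top[of 0]
      proof eventually_elim
        case (elim t)
        show ?case
          using vel_w[OF elim] abs_ge_self by (simp add: mult.commute order_trans)
      qed
    qed
    also have "(\<lambda>t. (2 * E + \<alpha>\<^sup>2 * (norm (w t))\<^sup>2) * exp (- \<alpha> * t))
        \<in> O[at_top](\<lambda>t. \<rho> t * exp (- \<alpha> * t))"
      using 1 by (intro landau_o.big.mult) auto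
    finally have vel: "(\<lambda>t. (norm (vel x t, vel l t))\<^sup>2) \<in> O[at_top](\<lambda>t. \<rho> t * exp (- \<alpha> * t))" .
    have pos: "(\<lambda>t. (norm (u t))\<^sup>2) \<in> O[at_top](\<lambda>t. \<rho> t * exp (- \<alpha> * t))"
      unfolding u_w mult.commute[of "exp _"] using \<open>(\<lambda>t. (norm (w t))\<^sup>2) \<in> O[at_top](\<rho>)\<close>
      by (intro landau_o.big.mult) auto
    show ?thesis
      unfolding gap using vel pos by (simp add: u_def)
  qed
  have "\<alpha>\<^sup>2 < 4 * \<beta> \<Longrightarrow> ?thesis"
  proof -
    assume lt: "\<alpha>\<^sup>2 < 4 * \<beta>"
    define C where "C = E / (\<beta> - \<alpha>\<^sup>2 / 4)"
    have "(norm (w t))\<^sup>2 \<le> C * 1" if "t \<ge> 0" for t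
    proof -
      have "(\<beta> - \<alpha>\<^sup>2 / 4) * (norm (w t))\<^sup>2 \<le> E"
        using p_le[OF that] zero_le_power2[of "norm (p t)"] by linarith
      thus ?thesis unfolding C_def using lt by (simp add: pos_le_divide_eq mult.commute)
    qed
    hence "eventually (\<lambda>t. (norm (w t))\<^sup>2 \<le> C * 1) at_top"
      by (intro eventually_at_top_linorderI[of 0])
    thus ?thesis
      using rates[of C "\<lambda>_. 1"] lt by simp
  qed
  moreover have "\<alpha>\<^sup>2 = 4 * \<beta> \<Longrightarrow> ?thesis"
  proof -
    assume eq: "\<alpha>\<^sup>2 = 4 * \<beta>"
    define C where "C = norm (w 0) + sqrt E"
    \<comment> \<open>In the critical case \<open>p_le\<close> bounds only \<open>p\<close>, so
      \<open>w\<close> may grow linearly; from time 1 on, the initial value is absorbed into the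
      multiple of \<open>t\<close>.\<close>
    have "(norm (w t))\<^sup>2 \<le> C\<^sup>2 * t\<^sup>2" if "t \<ge> 1" for t
    proof -
      have "norm (w t) \<le> norm (w 0) + sqrt E * t"
        using that eq p_le by (intro linear_growth[OF w']) auto
      also have "\<dots> \<le> norm (w 0) * t + sqrt E * t"
        using mult_left_mono[OF that, of "norm (w 0)"] by simp
      finally have "norm (w t) \<le> C * t" by (simp add: C_def algebra_simps)
      thus ?thesis using power_mono[of "norm (w t)" "C * t" 2] by (simp add: power_mult_distrib)
    qed
    hence "eventually (\<lambda>t. (norm (w t))\<^sup>2 \<le> C\<^sup>2 * t\<^sup>2) at_top"
      by (intro eventually_at_top_linorderI[of 1])
    moreover have "eventually (\<lambda>t::real. 1 \<le> t\<^sup>2) at_top"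
      by (intro eventually_at_top_linorderI[of 1]) simp
    ultimately show ?thesis
      using rates[of "C\<^sup>2" "\<lambda>t. t\<^sup>2"] eq by simp
  qed
  moreover have "\<alpha>\<^sup>2 > 4 * \<beta> \<Longrightarrow> ?thesis"
  proof -
    assume gt: "\<alpha>\<^sup>2 > 4 * \<beta>"
    define \<delta> where "\<delta> = sqrt (\<alpha>\<^sup>2 - 4 * \<beta>)"
    have "\<delta> > 0" and \<delta>: "\<delta>\<^sup>2 = \<alpha>\<^sup>2 - 4 * \<beta>"
      using gt by (auto simp: \<delta>_def)
    \<comment> \<open>Here \<beta> - \<open>\<alpha>\<^sup>2 / 4\<close> equals
      \<open>- (\<delta> / 2)\<^sup>2\<close>, so the Gronwall estimate applies with
      \<open>k = \<delta> / 2\<close> and gives the rate \<delta>.\<close>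
    have "(norm (p t))\<^sup>2 \<le> E + (\<delta> / 2)\<^sup>2 * (norm (w t))\<^sup>2" if "t \<ge> 0" for t
      using p_le[OF that] by (simp add: power_divide \<delta> algebra_simps diff_divide_distrib)
    then obtain C where C: "\<And>t. t \<ge> 0 \<Longrightarrow> (norm (w t))\<^sup>2 \<le> C * exp (\<delta> * t)"
      using exponential_growth[OF w', of E "\<delta> / 2"] \<open>\<delta> > 0\<close> by auto
    have "eventually (\<lambda>t. (norm (w t))\<^sup>2 \<le> C * exp (\<delta> * t)) at_top"
      using C by (intro eventually_at_top_linorderI[of 0])
    moreover have "eventually (\<lambda>t. 1 \<le> exp (\<delta> * t)) at_top"
      using \<open>\<delta> > 0\<close> by (intro eventually_at_top_linorderI[of 0]) simp
    moreover have "exp (\<delta> * t) * exp (- \<alpha> * t) = exp (- (\<alpha> - \<delta>) * t)" for t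
      by (simp add: algebra_simps flip: exp_add)
    ultimately show ?thesis
      using rates[of C "\<lambda>t. exp (\<delta> * t)"] gt by (simp add: Let_def flip: \<delta>_def)
  qed
  ultimately show ?thesis by linarith
qed

end
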